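(* Let $\delta,a,K\in\mathbb{N}$ satisfy $2\le a\le K-2$, let $f$ be a bistable reaction function with viability constant $a$ and capacity $K$, and let $F$ be the update rule of the bistable reaction-diffusion cellular automaton determined by $\delta$ and $f$. Then for no integer $c$ with $|c|\ge 2$ does there exist a traveling wave with speed $c$, i.e. there is no wave profile $w$ such that $F(w)_n=w_{n-c}$ for all $n\in\mathbb{Z}$.
   Context: $\mathbb{N}=\{1,2,\dots\}$, $\mathbb{N}_0=\mathbb{N}\cup\{0\}$; a subscript $\mathbb{Z}$ on an interval denotes its intersection with $\mathbb{Z}$, e.g. $(0,a)_{\mathbb{Z}}=(0,a)\cap\mathbb{Z}$. For $\delta\in\mathbb{N}$ define $h_\delta(m,n)\in\mathbb{Z}$ for $m,n\in\mathbb{N}_0$ by: $h_\delta(m,n)=\delta$ if $m-n\ge 2\delta$; $h_\delta(m,n)=-\delta$ if $m-n\le -2\delta$; for $j=1,\dots,\delta-1$, $h_\delta(m,n)=j$ if $m-n\in\{2j,2j+1\}$ and $h_\delta(m,n)=-j$ if $n-m\in\{2j,2j+1\}$; and $h_\delta(m,n)=0$ otherwise. For integers $a,K$ with $2\le a\le K-2$, a bistable reaction function with viability constant $a$ and capacity $K$ is a nondecreasing $f:\mathbb{N}_0\to\mathbb{N}_0$ with $f(0)=0$, $f(a)=a$, $f(K)=K$, $f(u)\in[0,u)_{\mathbb{Z}}$ for $u\in(0,a)_{\mathbb{Z}}$, $f(u)\in(u,K]_{\mathbb{Z}}$ for $u\in(a,K)_{\mathbb{Z}}$, and $f(u)\in[K,u)_{\mathbb{Z}}$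 for $u\in(K,\infty)_{\mathbb{Z}}$. The bistable reaction-diffusion cellular automaton determined by $\delta$ and $f$ is $u(t+1)=F(u(t))$, $t\in\mathbb{N}_0$, where for $u\in\mathbb{N}_0^{\mathbb{Z}}$, $n\in\mathbb{Z}$, $$F(u)_n=f(u_n)+h_\delta(f(u_{n-1}),f(u_n))+h_\delta(f(u_{n+1}),f(u_n)).$$ A wave profile is a sequence $w=(w_n)_{n\in\mathbb{Z}}$ of nonnegative integers for which there is $N\in\mathbb{N}$ with $w_n=0$ for $n\le 0$, $w_n=K$ for $n\ge N$, and $0=w_0<w_1\le w_2\le\dots\le w_{N-1}<w_N=K$. *)

theory Defs
  imports Main
begin

definition h :: "nat \<Rightarrow> nat \<Rightarrow> nat \<Rightarrow> int" where
  "h \<delta> m n =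
     (let d = int m - int n in
      if d \<ge> 2 * int \<delta> then int \<delta>
      else if d \<le> - 2 * int \<delta> then - int \<delta>
      else if \<exists>j\<in>{1..int \<delta> - 1}. d \<in> {2 * j, 2 * j + 1}
        then (THE j. j \<in> {1..int \<delta> - 1} \<and> d \<in> {2 * j, 2 * j + 1})
      else if \<exists>j\<in>{1..int \<delta> - 1}. - d \<in> {2 * j, 2 * j + 1}
        then - (THE j. j \<in> {1..int \<delta> - 1} \<and> - d \<in> {2 * j, 2 * j + 1})
      else 0)"

lemma h_eq: "h \<delta> m n = sgn (int m - int n) * min (int \<delta>) (\<bar>int m - int n\<bar> div 2)"
proof -
  define d where "d = int m - int n"
  have the: "(THE j. j \<in> {1..int \<delta> - 1} \<and> e \<in> {2 * j, 2 * j + 1}) = e div 2"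
    if "\<exists>j\<in>{1..int \<delta> - 1}. e \<in> {2 * j, 2 * j + 1}" for e :: int
    by (rule the_equality) (use that in auto)
  have mid: "(\<exists>j\<in>{1..int \<delta> - 1}. e \<in> {2 * j, 2 * j + 1}) \<longleftrightarrow> 2 \<le> e \<and> e < 2 * int \<delta>" for e :: int
  proof
    assume "2 \<le> e \<and> e < 2 * int \<delta>"
    then show "\<exists>j\<in>{1..int \<delta> - 1}. e \<in> {2 * j, 2 * j + 1}"
      by (intro bexI[of _ "e div 2"]) (simp_all, presburger+)
  qed auto
  have "h \<delta> m n =
     (if d \<ge> 2 * int \<delta> then int \<delta>
      else if d \<le> - 2 * int \<delta> then - int \<delta>
      else if 2 \<le> d \<and> d < 2 * int \<delta> then d div 2
      else if 2 \<le> - d \<and> - d < 2 * int \<delta> then - (- d div 2)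
      else 0)"
    unfolding h_def Let_def d_def[symmetric] using the mid by presburger
  also have "\<dots> = sgn d * min (int \<delta>) (\<bar>d\<bar> div 2)"
    by (simp add: sgn_if abs_if min_def) presburger
  finally show ?thesis by (simp add: d_def)
qed

definition bistable_reaction :: "nat \<Rightarrow> nat \<Rightarrow> (nat \<Rightarrow> nat) \<Rightarrow> bool" where
  "bistable_reaction a K f \<longleftrightarrow>
     mono f \<and> f 0 = 0 \<and> f a = a \<and> f K = K \<and>
     (\<forall>u\<in>{0<..<a}. f u \<in> {0..<u}) \<and>
     (\<forall>u\<in>{a<..<K}. f u \<in> {u<..K}) \<and>
     (\<forall>u\<in>{K<..}. f u \<in> {K..<u})"

(* The values are taken in the integers so that the subtraction is exact;
   they are nonnegative by F_nonneg, so F does map states to states. *)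
definition F :: "nat \<Rightarrow> (nat \<Rightarrow> nat) \<Rightarrow> (int \<Rightarrow> nat) \<Rightarrow> int \<Rightarrow> int" where
  "F \<delta> f u n =
     int (f (u n)) + h \<delta> (f (u (n - 1))) (f (u n)) + h \<delta> (f (u (n + 1))) (f (u n))"

lemma F_nonneg: "F \<delta> f u n \<ge> 0"
proof -
  have "2 * h \<delta> m k \<ge> - int k" for m k
    unfolding h_eq by (simp add: sgn_if abs_if min_def) presburger
  from this[of "f (u n)" "f (u (n - 1))"] this[of "f (u n)" "f (u (n + 1))"]
  show ?thesis using \<open>\<And>m k. 2 * h \<delta> m k \<ge> - int k\<close> unfolding F_def
    by (smt (verit, best))
qed

(* For N = 1 the chain reads 0 = w 0 < w 1 = K: the pure step profile is included. *)
definition wave_profile :: "nat \<Rightarrow> (int \<Rightarrow> nat) \<Rightarrow> bool" where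
  "wave_profile K w \<longleftrightarrow>
     (\<exists>N::int. N \<ge> 1 \<and>
        (\<forall>n\<le>0. w n = 0) \<and> (\<forall>n\<ge>N. w n = K) \<and>
        w 0 < w 1 \<and> (\<forall>n\<in>{1..<N - 1}. w n \<le> w (n + 1)) \<and> w (N - 1) < w N)"

definition traveling_wave :: "nat \<Rightarrow> nat \<Rightarrow> (nat \<Rightarrow> nat) \<Rightarrow> int \<Rightarrow> (int \<Rightarrow> nat) \<Rightarrow> bool" where
  "traveling_wave \<delta> K f c w \<longleftrightarrow>
     wave_profile K w \<and> (\<forall>n. F \<delta> f w n = int (w (n - c)))"

end

theory Submission
  imports Defs
begin

text \<open>
  The automaton only looks at nearest neighbours, so information travels at most one site per step.
  If a site and both its neighbours sit at the same fixed point of \<^term>\<open>f\<close>, the diffusion terms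
  vanish and the site keeps that value (\<open>F_fixed_plateau\<close>). For a profile that first reaches
  \<^term>\<open>K\<close> at site \<^term>\<open>N::int\<close>, site \<open>N + 1\<close> therefore keeps the value \<^term>\<open>K\<close>, so
  the edge of the plateau at \<^term>\<open>K\<close> cannot retreat by two sites; likewise site \<open>-1\<close>
  keeps the value 0, so the edge of the plateau at 0 cannot retreat by two sites. A shift with
  \<open>\<bar>c\<bar> \<ge> 2\<close> would require one of the two: here monotonicity of the profile is what makes it
  differ from \<^term>\<open>K\<close> everywhere left of \<^term>\<open>N::int\<close> and from 0 everywhere right of site 0
  (\<open>wave_profile_edges\<close>).
\<close>

lemma h_self: "h \<delta> m m = 0"
  by (simp add: h_eq)

lemma F_fixed_plateau:
  assumes "f v = v" and "u (n - 1) = v" "u n = v" "u (n + 1) = v"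
  shows "F \<delta> f u n = int v"
  using assms by (simp add: F_def h_self)

text \<open>
  The profile condition compares adjacent sites only, and only on the transition zone; the strict
  inequalities at the two ends of that zone spread along it by monotonicity.
\<close>
lemma wave_profile_edges:
  assumes "wave_profile K w"
  obtains N :: int where "\<forall>n\<le>0. w n = 0" "\<forall>n\<ge>N. w n = K"
    "\<forall>n\<ge>1. w n > 0" "\<forall>n<N. w n < K"
proof -
  from assms obtain N :: int where N: "N \<ge> 1"
    and left: "\<And>n. n \<le> 0 \<Longrightarrow> w n = 0" and right: "\<And>n. n \<ge> N \<Longrightarrow> w n = K"
    and first: "w 0 < w 1" and step: "\<And>n. n \<in> {1..<N - 1} \<Longrightarrow> w n \<le> w (n + 1)"
    and last: "w (N - 1) < w N"
    unfolding wave_profile_def by blast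
  have "K > 0"
    using last right[of N] by simp
  have up: "n < N \<longrightarrow> 0 < w n" if "1 \<le> n" for n
    using that
  proof (induction n rule: int_ge_induct)
    case base
    show ?case using first by simp
  next
    case (step n)
    then show ?case using \<open>\<And>n. n \<in> {1..<N - 1} \<Longrightarrow> w n \<le> w (n + 1)\<close>[of n] by force
  qed
  have down: "1 \<le> n \<longrightarrow> w n < K" if "n \<le> N - 1" for n
    using that
  proof (induction n rule: int_le_induct)
    case base
    show ?case using last right[of N] by simp
  next
    case (step n)
    then show ?case using \<open>\<And>n. n \<in> {1..<N - 1} \<Longrightarrow> w n \<le> w (n + 1)\<close>[of "n - 1"] by force
  qed
  show thesis
  proof (rule that[of N])
    show "\<forall>n\<ge>1. w n > 0"
      using up right \<open>K > 0\<close> by (metis not_less)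
    show "\<forall>n<N. w n < K"
    proof (intro allI impI)
      show "w n < K" if "n < N" for n
        using down[of n] left[of n] \<open>K > 0\<close> that by (cases "1 \<le> n") auto
    qed
  qed (use left right in auto)
qed

theorem lemma3p1:
  fixes \<delta> a K :: nat and f :: "nat \<Rightarrow> nat"
  assumes "\<delta> \<ge> 1" and "2 \<le> a" and "a + 2 \<le> K"
    and "bistable_reaction a K f"
  shows "\<not> (\<exists>c::int. \<bar>c\<bar> \<ge> 2 \<and> (\<exists>w. traveling_wave \<delta> K f c w))"
proof
  assume "\<exists>c::int. \<bar>c\<bar> \<ge> 2 \<and> (\<exists>w. traveling_wave \<delta> K f c w)"
  then obtain c :: int and w where c: "\<bar>c\<bar> \<ge> 2" and "wave_profile K w"
    and wave: "\<And>n. F \<delta> f w n = int (w (n - c))"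
    unfolding traveling_wave_def by blast
  from \<open>wave_profile K w\<close> obtain N :: int
    where zero: "\<forall>n\<le>0. w n = 0" and cap: "\<forall>n\<ge>N. w n = K"
      and pos: "\<forall>n\<ge>1. w n > 0" and below: "\<forall>n<N. w n < K"
    by (rule wave_profile_edges) blast
  have fixed: "f 0 = 0" "f K = K"
    using assms(4) by (auto simp: bistable_reaction_def)
  show False
  proof (cases "c \<ge> 2")
    case True
    have "F \<delta> f w (N + 1) = int K"
      by (rule F_fixed_plateau) (simp_all add: fixed cap)
    moreover have "w (N + 1 - c) < K"
      using True by (simp add: below)
    ultimately show False
      using wave[of "N + 1"] by simp
  next
    case False
    with c have "c \<le> -2" by simp
    have "F \<delta> f w (-1) = int 0"
      by (rule F_fixed_plateau) (simp_all add: fixed zero)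
    moreover have "w (-1 - c) > 0"
      using \<open>c \<le> -2\<close> by (simp add: pos)
    ultimately show False
      using wave[of "-1"] by simp
  qed
qed

end
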